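(* Let $p\ge 2$, $A\in\mathbb{Z}^{m\times n}$, $b\in\mathbb{Z}^m$, $C\in\mathbb{Z}^{p\times n}$, and consider the multi-objective combinatorial optimization problem (MOCO) $\min_{x\in\mathcal{X}} Cx$ with feasible set $\mathcal{X}=\{x\in\{0,1\}^n : Ax=b\}$ and outcome set $\mathcal{Y}=\{Cx : x\in\mathcal{X}\}$. Assume that its set of non-dominated points $\mathcal{Y}_N$ is non-empty. Then the set of supported non-dominated points equals the set of non-dominated points on the non-dominated frontier: $$\mathcal{Y}_S=\mathcal{Y}_{SNF}.$$
   Context: For $y^1,y^2\in\mathbb{R}^p$: $y^1\leqq y^2$ means $y^1_i\le y^2_i$ for all $i$; $y^1\le y^2$ means $y^1\leqq y^2$ and $y^1\neq y^2$; $y^1<y^2$ means $y^1_i<y^2_i$ for all $i$. Let $\mathbb{R}^p_{\geqq}=\{y\in\mathbb{R}^p : y\geqq 0\}$ and $\mathbb{R}^p_{>}=\{y\in\mathbb{R}^p: y>0\}$. Sums and differences of sets are Minkowski sums and differences. A feasible solution $x^*\in\mathcal{X}$ is efficient if there is no $x\in\mathcal{X}$ with $Cx\le Cx^*$ (that is, $Cx\leqq Cx^*$ and $Cx\ne Cx^*$); its image $Cx^*$ is then called non-dominated. $\mathcal{Y}_N\subseteq\mathcal{Y}$ is the set of non-dominated points. Let $\Lambda_p=\{\lambda\in\mathbb{R}^p_{>} : \sum_{i=1}^p\lambda_i=1\}$, and let $P_\lambda$ denote the weighted-sum problem $\min_{x\in\mathcal{X}}\lambda^\top Cx$. An efficient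 solution is supported if it is an optimal solution of $P_\lambda$ for some $\lambda\in\Lambda_p$ (strictly positive weights); its image is then called a supported non-dominated point. $\mathcal{Y}_S$ is the set of all supported non-dominated points. $\mathcal{Y}_{SNF}$ is the set of all $y\in\mathcal{Y}_N$ that lie on the non-dominated frontier $\{y\in\operatorname{conv}(\mathcal{Y}_N) : \operatorname{conv}(\mathcal{Y}_N)\cap(y-\mathbb{R}^p_{\geqq})=\{y\}\}$. *)

theory Defs
  imports "HOL-Analysis.Analysis"
begin

text \<open>The library order \<open>\<le>\<close> on \<open>real ^ 'p\<close> is the componentwise order, written
  with a double-bar inequality sign in the literature on multi-objective optimization. The
  literature's \<open>y1 \<le> y2\<close> (componentwise and not equal) is spelled out below as
  \<open>y1 \<le> y2 \<and> y1 \<noteq> y2\<close>.\<close>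

definition feasible_set :: "int ^ 'n ^ 'm \<Rightarrow> int ^ 'm \<Rightarrow> (int ^ 'n) set" where
  "feasible_set A b = {x. (\<forall>j. x $ j \<in> {0, 1}) \<and> A *v x = b}"

text \<open>The integer vector \<open>C x\<close>, regarded as a point of real p-space.\<close>

definition outcome :: "int ^ 'n ^ 'p \<Rightarrow> int ^ 'n \<Rightarrow> real ^ 'p" where
  "outcome C x = (\<chi> i. real_of_int ((C *v x) $ i))"

definition efficient :: "int ^ 'n ^ 'm \<Rightarrow> int ^ 'm \<Rightarrow> int ^ 'n ^ 'p \<Rightarrow> int ^ 'n \<Rightarrow> bool" where
  "efficient A b C x \<longleftrightarrow> x \<in> feasible_set A b \<and>
     \<not> (\<exists>x' \<in> feasible_set A b. outcome C x' \<le> outcome C x \<and> outcome C x' \<noteq> outcome C x)"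

definition nondominated_points ::
  "int ^ 'n ^ 'm \<Rightarrow> int ^ 'm \<Rightarrow> int ^ 'n ^ 'p \<Rightarrow> (real ^ 'p) set" where
  "nondominated_points A b C = {outcome C x | x. efficient A b C x}"

definition positive_weights :: "(real ^ 'p) set" where
  "positive_weights = {w. (\<forall>i. w $ i > 0) \<and> (\<Sum>i\<in>UNIV. w $ i) = 1}"

definition weighted_sum_optimal ::
  "int ^ 'n ^ 'm \<Rightarrow> int ^ 'm \<Rightarrow> int ^ 'n ^ 'p \<Rightarrow> real ^ 'p \<Rightarrow> int ^ 'n \<Rightarrow> bool" where
  "weighted_sum_optimal A b C w x \<longleftrightarrow>
     is_arg_min (\<lambda>x. w \<bullet> outcome C x) (\<lambda>x. x \<in> feasible_set A b) x"

definition supported :: "int ^ 'n ^ 'm \<Rightarrow> int ^ 'm \<Rightarrow> int ^ 'n ^ 'p \<Rightarrow> int ^ 'n \<Rightarrow> bool" where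
  "supported A b C x \<longleftrightarrow>
     efficient A b C x \<and> (\<exists>w \<in> positive_weights. weighted_sum_optimal A b C w x)"

definition supported_nondominated_points ::
  "int ^ 'n ^ 'm \<Rightarrow> int ^ 'm \<Rightarrow> int ^ 'n ^ 'p \<Rightarrow> (real ^ 'p) set" where
  "supported_nondominated_points A b C = {outcome C x | x. supported A b C x}"

text \<open>The set \<open>{y - d | d. 0 \<le> d}\<close> is the Minkowski difference of \<open>{y}\<close> and the
  nonnegative orthant.\<close>

definition nondominated_frontier ::
  "int ^ 'n ^ 'm \<Rightarrow> int ^ 'm \<Rightarrow> int ^ 'n ^ 'p \<Rightarrow> (real ^ 'p) set" where
  "nondominated_frontier A b C =
     {y \<in> convex hull (nondominated_points A b C).
        convex hull (nondominated_points A b C) \<inter> {y - d | d. 0 \<le> d} = {y}}"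

definition nondominated_points_on_frontier ::
  "int ^ 'n ^ 'm \<Rightarrow> int ^ 'm \<Rightarrow> int ^ 'n ^ 'p \<Rightarrow> (real ^ 'p) set" where
  "nondominated_points_on_frontier A b C =
     {y \<in> nondominated_points A b C. y \<in> nondominated_frontier A b C}"

end

theory Submission
  imports Defs
begin

text \<open>A strictly positive weight vector that is minimal at \<open>y\<close> over \<open>\<Y>\<^sub>N\<close>
  is minimal over the convex hull, so no hull point lies strictly below \<open>y\<close>. Conversely, if no
  hull point does, the cone generated by \<open>\<Y>\<^sub>N - y\<close> and the unit vectors contains none of
  the \<open>-e\<^sub>i\<close>. Being finitely generated, this cone is closed, so each \<open>-e\<^sub>i\<close> is strictly
  separated from it by a vector \<open>w\<^sub>i\<close> of the dual cone; \<open>w\<^sub>i\<close> is nonnegative and positive in its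
  \<open>i\<close>-th entry, and the sum of the \<open>w\<^sub>i\<close> is a strictly positive weight vector supporting \<open>y\<close>.\<close>

lemma inner_nonneg_vec:
  fixes v w :: "real ^ 'p"
  assumes "0 \<le> v" "0 \<le> w"
  shows "0 \<le> v \<bullet> w"
  using assms by (auto simp: inner_vec_def less_eq_vec_def intro!: sum_nonneg)

lemma inner_pos_vec:
  fixes v w :: "real ^ 'p"
  assumes "\<And>i. 0 < v $ i" "0 \<le> w" "w \<noteq> 0"
  shows "0 < v \<bullet> w"
proof -
  obtain i where "w $ i \<noteq> 0"
    using assms(3) by (auto simp: vec_eq_iff)
  moreover have w: "0 \<le> w $ j" for j
    using assms(2) by (simp add: less_eq_vec_def)
  ultimately have "0 < v $ i * w $ i"
    using assms(1) by (metis less_eq_real_def mult_pos_pos)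
  then show ?thesis
    unfolding inner_vec_def
    by (intro sum_pos2[of UNIV i]) (auto simp: assms(1) less_imp_le w)
qed

text \<open>A strictly separating hyperplane has a negative offset \<open>r\<close>, because
  \<open>0\<close> lies in \<open>K\<close>. Since \<open>K\<close> is closed under scaling, the
  offset can then be moved to \<open>0\<close> on the side of \<open>K\<close>.\<close>

lemma closed_convex_cone_separation:
  fixes K :: "'a::euclidean_space set"
  assumes "convex_cone K" "closed K" "z \<notin> K"
  obtains a where "a \<bullet> z < 0" "\<And>x. x \<in> K \<Longrightarrow> 0 \<le> a \<bullet> x"
proof -
  have "convex K"
    using assms(1) by (simp add: convex_cone_def)
  then obtain a r where az: "a \<bullet> z < r" and aK: "\<And>x. x \<in> K \<Longrightarrow> r < a \<bullet> x"
    using separating_hyperplane_closed_point assms(2,3) by metis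
  have r: "r < 0"
    using aK[of 0] convex_cone_contains_0[OF assms(1)] by simp
  have "0 \<le> a \<bullet> x" if "x \<in> K" for x
  proof (rule ccontr)
    assume neg: "\<not> 0 \<le> a \<bullet> x"
    \<comment> \<open>Both \<open>r\<close> and \<open>a \<bullet> x\<close> are negative, so this
      is a nonnegative scaling. It brings the value of \<open>a\<close> to exactly \<open>r\<close>,
      which no point of \<open>K\<close> attains.\<close>
    then have "(r / (a \<bullet> x)) *\<^sub>R x \<in> K"
      using r that by (intro convex_cone_scaleR[OF assms(1)]) (auto simp: divide_nonpos_nonpos)
    from aK[OF this] neg show False
      by simp
  qed
  with az r that show thesis
    by force
qed

lemma positive_functional_minimal_on_finite:
  fixes N :: "(real ^ 'p) set"
  assumes "finite N"
    and hull: "\<And>v. v \<in> convex hull N \<Longrightarrow> v \<le> y \<Longrightarrow> v = y"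
  obtains w where "\<And>i. 0 < w $ i" "\<And>z. z \<in> N \<Longrightarrow> w \<bullet> y \<le> w \<bullet> z"
proof -
  \<comment> \<open>The directions from \<open>y\<close> to the points of \<open>N\<close>, written
    as a translation by \<open>- y\<close> so that the hull of \<open>G\<close> is the translated
    hull of \<open>N\<close>.\<close>
  define G where "G = (\<lambda>z. - y + z) ` N"
  define P where "P = {d :: real ^ 'p. 0 \<le> d}"
  define K where "K = convex_cone hull (G \<union> Basis)"
  have "finite G"
    by (simp add: G_def assms(1))
  then have "closed K"
    by (simp add: K_def closed_convex_cone_hull)
  have cone: "convex_cone K"
    by (simp add: K_def convex_cone_convex_cone_hull)
  \<comment> \<open>The frontier condition in terms of cones: a nonzero \<open>x\<close> in this
    cone is a positive multiple of some \<open>v - y\<close> with \<open>v\<close> in the hull of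
    \<open>N\<close>, so \<open>x \<le> 0\<close> would force \<open>v \<le> y\<close>, hence
    \<open>v = y\<close>.\<close>
  have G_hull: "x = 0" if x: "x \<in> convex_cone hull G" and "x \<le> 0" for x
  proof (rule ccontr)
    assume "x \<noteq> 0"
    with x obtain u c where "u \<in> convex hull G" and c: "0 \<le> c" "x = c *\<^sub>R u"
      by (auto simp: convex_cone_hull_convex_hull)
    then have "u \<in> (\<lambda>z. - y + z) ` (convex hull N)"
      unfolding G_def convex_hull_translation by blast
    then obtain v where v: "v \<in> convex hull N" "x = c *\<^sub>R (v - y)"
      using c(2) by force
    have "0 < c"
      using c \<open>x \<noteq> 0\<close> by (cases "c = 0") auto
    then have "v \<le> y"
      using \<open>x \<le> 0\<close> v(2) by (auto simp: less_eq_vec_def mult_le_0_iff)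
    with hull v \<open>x \<noteq> 0\<close> show False
      by auto
  qed
  have "convex_cone P"
    by (auto simp: P_def convex_cone_iff less_eq_vec_def)
  moreover have "Basis \<subseteq> P"
    by (auto simp: P_def Basis_vec_def less_eq_vec_def axis_def)
  ultimately have B_hull: "convex_cone hull Basis \<subseteq> P"
    by (simp add: hull_minimal)
  have "axis i 1 \<in> (Basis :: (real ^ 'p) set)" for i
    by (auto simp: Basis_vec_def)
  then have axis_K: "axis i 1 \<in> K" for i
    unfolding K_def by (intro hull_inc) auto
  have "- axis i 1 \<notin> K" for i
  proof
    assume "- axis i 1 \<in> K"
    \<comment> \<open>The cone generated by a union is the Minkowski sum of the two cones. Since
      \<open>d\<close> is nonnegative, \<open>x\<close> is nonpositive and so vanishes; but
      \<open>d = - axis i 1\<close> has a negative entry.\<close>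
    then obtain x d where x: "x \<in> convex_cone hull G" and d: "0 \<le> d" and eq: "- axis i 1 = x + d"
      using B_hull by (auto simp: K_def convex_cone_hull_Un P_def)
    have x_eq: "x = - axis i 1 - d"
      using eq by (simp add: algebra_simps)
    then have "x \<le> 0"
      using d by (auto simp: less_eq_vec_def axis_def intro: order_trans[of _ 0])
    with x have "x = 0"
      by (rule G_hull)
    then have "d $ i = - 1"
      using eq by (metis add_0 axis_nth vector_uminus_component)
    with d show False
      by (auto simp: less_eq_vec_def dest: spec[of _ i])
  qed
  then have "\<exists>a. a \<bullet> - axis i 1 < 0 \<and> (\<forall>x\<in>K. 0 \<le> a \<bullet> x)" for i
    using closed_convex_cone_separation[OF cone \<open>closed K\<close>] by metis
  then obtain a where a_neg: "\<And>i. a i \<bullet> - axis i 1 < 0" and a_K: "\<And>i x. x \<in> K \<Longrightarrow> 0 \<le> a i \<bullet> x"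
    by metis
  define w where "w = (\<Sum>i\<in>UNIV. a i)"
  show thesis
  proof
    fix i
    have "0 \<le> a j $ i" for j
      using a_K[OF axis_K, of j i] by (simp add: inner_axis)
    moreover have "0 < a i $ i"
      using a_neg[of i] by (simp add: inner_axis)
    ultimately show "0 < w $ i"
      unfolding w_def sum_component by (intro sum_pos2[of UNIV i]) auto
  next
    fix z assume "z \<in> N"
    then have "z - y \<in> K"
      unfolding K_def G_def by (intro hull_inc) auto
    then have "0 \<le> w \<bullet> (z - y)"
      unfolding w_def inner_sum_left by (intro sum_nonneg a_K)
    then show "w \<bullet> y \<le> w \<bullet> z"
      by (simp add: inner_diff_right)
  qed
qed

lemma finite_feasible_set: "finite (feasible_set A b)"
proof (rule finite_imageD)
  have "vec_nth ` feasible_set A b \<subseteq> {f. \<forall>j. f j \<in> {0, 1}}"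
    by (auto simp: feasible_set_def)
  moreover have "finite {f :: 'a \<Rightarrow> int. \<forall>j. f j \<in> {0, 1}}"
    \<comment> \<open>The default value \<open>0\<close> is prescribed only outside the domain
      \<open>UNIV\<close>, so it restricts nothing.\<close>
    using finite_set_of_finite_funs[of "UNIV :: 'a set" "{0, 1 :: int}" 0] by simp
  ultimately show "finite (vec_nth ` feasible_set A b)"
    by (rule finite_subset)
  show "inj_on vec_nth (feasible_set A b)"
    by (simp add: inj_on_def vec_nth_inject)
qed

lemma nondominated_points_subset: "nondominated_points A b C \<subseteq> outcome C ` feasible_set A b"
  by (auto simp: nondominated_points_def efficient_def)

lemma finite_nondominated_points: "finite (nondominated_points A b C)"
  using finite_feasible_set nondominated_points_subset finite_surj by metis

text \<open>Every point of a finite ordered set lies above a minimal one, and the minimal outcomes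
  are the non-dominated points.\<close>

lemma nondominated_below_feasible:
  assumes "x \<in> feasible_set A b"
  obtains z where "z \<in> nondominated_points A b C" "z \<le> outcome C x"
proof -
  obtain z where z: "z \<in> outcome C ` feasible_set A b" "z \<le> outcome C x"
    and min: "\<forall>z' \<in> outcome C ` feasible_set A b. z' \<le> z \<longrightarrow> z = z'"
    using finite_has_minimal2[of "outcome C ` feasible_set A b" "outcome C x"]
      finite_feasible_set assms by blast
  then obtain x' where "x' \<in> feasible_set A b" "z = outcome C x'"
    by blast
  with min have "z \<in> nondominated_points A b C"
    by (fastforce simp: nondominated_points_def efficient_def)
  with z(2) show thesis
    by (rule that[rotated -1])
qed

lemma mem_nondominated_frontier_iff:
  assumes "y \<in> nondominated_points A b C"
  shows "y \<in> nondominated_frontier A b C \<longleftrightarrow>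
    (\<forall>v \<in> convex hull nondominated_points A b C. v \<le> y \<longrightarrow> v = y)"
proof -
  \<comment> \<open>The witness for \<open>v \<le> y\<close> is \<open>d = y - v\<close>. As
    \<open>y\<close> itself lies in the hull, the intersection equals \<open>{y}\<close> as soon as
    it is contained in \<open>{y}\<close>.\<close>
  have "{y - d | d. 0 \<le> d} = {v. v \<le> y}"
    by (auto intro!: exI[of _ "y - _"])
  then show ?thesis
    using hull_inc[OF assms, of convex] by (auto simp: nondominated_frontier_def)
qed

lemma supported_imp_on_frontier:
  assumes "supported A b C x"
  shows "outcome C x \<in> nondominated_frontier A b C"
proof -
  let ?N = "nondominated_points A b C"
  let ?y = "outcome C x"
  have "?y \<in> ?N"
    using assms by (auto simp: supported_def nondominated_points_def)
  obtain w where w: "\<And>i. 0 < w $ i" and opt: "weighted_sum_optimal A b C w x"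
    using assms by (auto simp: supported_def positive_weights_def)
  have "?N \<subseteq> {z. w \<bullet> z \<ge> w \<bullet> ?y}"
    using nondominated_points_subset opt
    by (fastforce simp: weighted_sum_optimal_def is_arg_min_linorder)
  then have hull: "convex hull ?N \<subseteq> {z. w \<bullet> z \<ge> w \<bullet> ?y}"
    by (intro hull_minimal convex_halfspace_ge)
  have "v = ?y" if "v \<in> convex hull ?N" "v \<le> ?y" for v
  proof (rule ccontr)
    assume "v \<noteq> ?y"
    \<comment> \<open>Strict positivity of the weights enters here: \<open>?y - v\<close> is
      nonnegative and nonzero, so it has a positive weighted sum.\<close>
    with that(2) have "0 < w \<bullet> (?y - v)"
      by (intro inner_pos_vec w) auto
    with hull that(1) show False
      by (auto simp: inner_diff_right)
  qed
  with mem_nondominated_frontier_iff[OF \<open>?y \<in> ?N\<close>] show ?thesis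
    by blast
qed

text \<open>Nonnegative weights are monotone and each feasible outcome has a non-dominated point
  below it, so a bound on the non-dominated points extends to all feasible outcomes.\<close>

lemma weighted_sum_optimalI:
  assumes "x \<in> feasible_set A b" "0 \<le> w"
    and min: "\<And>z. z \<in> nondominated_points A b C \<Longrightarrow> w \<bullet> outcome C x \<le> w \<bullet> z"
  shows "weighted_sum_optimal A b C w x"
  unfolding weighted_sum_optimal_def is_arg_min_linorder
proof (intro conjI allI impI)
  fix x' assume "x' \<in> feasible_set A b"
  then obtain z where z: "z \<in> nondominated_points A b C" "z \<le> outcome C x'"
    by (rule nondominated_below_feasible)
  have "0 \<le> w \<bullet> (outcome C x' - z)"
    using assms(2) z(2) by (intro inner_nonneg_vec) auto
  with min[OF z(1)] show "w \<bullet> outcome C x \<le> w \<bullet> outcome C x'"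
    by (simp add: inner_diff_right)
qed (fact assms(1))

lemma on_frontier_imp_supported:
  assumes "efficient A b C x" "outcome C x \<in> nondominated_frontier A b C"
  shows "supported A b C x"
proof -
  let ?N = "nondominated_points A b C"
  have "outcome C x \<in> ?N"
    using assms(1) by (auto simp: nondominated_points_def)
  then have hull: "\<And>v. v \<in> convex hull ?N \<Longrightarrow> v \<le> outcome C x \<Longrightarrow> v = outcome C x"
    using assms(2) mem_nondominated_frontier_iff by blast
  obtain w where w: "\<And>i. 0 < w $ i"
    and min: "\<And>z. z \<in> ?N \<Longrightarrow> w \<bullet> outcome C x \<le> w \<bullet> z"
    using positive_functional_minimal_on_finite[OF finite_nondominated_points hull] by metis
  \<comment> \<open>Dividing by the positive number \<open>s\<close> makes the weights sum to one
    and preserves the minimality of \<open>x\<close>.\<close>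
  define s where "s = (\<Sum>i\<in>UNIV. w $ i)"
  have s: "0 < s"
    unfolding s_def using w by (intro sum_pos) auto
  have "(1 / s) *\<^sub>R w \<in> positive_weights"
    using w s by (simp add: positive_weights_def s_def flip: sum_divide_distrib)
  moreover have "weighted_sum_optimal A b C ((1 / s) *\<^sub>R w) x"
  proof (rule weighted_sum_optimalI)
    show "x \<in> feasible_set A b"
      using assms(1) by (simp add: efficient_def)
    show "0 \<le> (1 / s) *\<^sub>R w"
      using w s by (simp add: less_eq_vec_def less_imp_le)
  qed (use min s in \<open>simp add: divide_right_mono\<close>)
  ultimately show ?thesis
    using assms(1) by (auto simp: supported_def)
qed

theorem theorem2p5:
  fixes A :: "int ^ 'n ^ 'm" and b :: "int ^ 'm" and C :: "int ^ 'n ^ 'p"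
  assumes "CARD('p) \<ge> 2"
    and "nondominated_points A b C \<noteq> {}"
  shows "supported_nondominated_points A b C = nondominated_points_on_frontier A b C"
proof (intro equalityI subsetI)
  fix y assume "y \<in> supported_nondominated_points A b C"
  then obtain x where x: "y = outcome C x" "supported A b C x"
    by (auto simp: supported_nondominated_points_def)
  moreover from x have "y \<in> nondominated_points A b C"
    by (auto simp: supported_def nondominated_points_def)
  ultimately show "y \<in> nondominated_points_on_frontier A b C"
    by (simp add: nondominated_points_on_frontier_def supported_imp_on_frontier)
next
  fix y assume "y \<in> nondominated_points_on_frontier A b C"
  then obtain x where "y = outcome C x" "efficient A b C x" "y \<in> nondominated_frontier A b C"
    by (auto simp: nondominated_points_on_frontier_def nondominated_points_def)
  then show "y \<in> supported_nondominated_points A b C"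
    using on_frontier_imp_supported unfolding supported_nondominated_points_def by blast
qed

end
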